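(* Let $n$ be a positive integer and let $G$ be a countably infinite abelian group such that $nG=0$ (i.e. $nx=0$ for every $x\in G$). Then the only locally minimal group topology on $G$ is the discrete topology.
   Context: A group topology on a group $G$ is a topology making the group operation and inversion continuous. A Hausdorff topological group $(G,\tau)$ is called locally minimal (and $\tau$ is then called a locally minimal group topology on $G$) if there exists a $\tau$-neighbourhood $U$ of the identity such that for every Hausdorff group topology $\tau'$ on $G$ that is weaker than $\tau$ (i.e. $\tau'\subseteq\tau$), if $U$ is a $\tau'$-neighbourhood of the identity, then $\tau'=\tau$. Here a neighbourhood of a point is a set containing an open set that contains the point. In particular, locally minimal group topologies are Hausdorff by definition. *)

theory Defs
  imports "HOL-Algebra.Group" "HOL-Analysis.Product_Topology" "HOL-Analysis.T1_Spaces"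
    "HOL-Library.Countable_Set"
begin

definition group_topology :: "('a, 'b) monoid_scheme \<Rightarrow> 'a topology \<Rightarrow> bool" where
  "group_topology G T \<longleftrightarrow>
     topspace T = carrier G \<and>
     continuous_map (prod_topology T T) T (\<lambda>(x, y). x \<otimes>\<^bsub>G\<^esub> y) \<and>
     continuous_map T T (\<lambda>x. inv\<^bsub>G\<^esub> x)"

text \<open>Neighbourhoods are not required to be open.\<close>

definition neighbourhood_of :: "'a topology \<Rightarrow> 'a \<Rightarrow> 'a set \<Rightarrow> bool" where
  "neighbourhood_of T x U \<longleftrightarrow>
     U \<subseteq> topspace T \<and> (\<exists>V. openin T V \<and> x \<in> V \<and> V \<subseteq> U)"

definition weaker_topology :: "'a topology \<Rightarrow> 'a topology \<Rightarrow> bool" where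
  "weaker_topology T' T \<longleftrightarrow> (\<forall>V. openin T' V \<longrightarrow> openin T V)"

definition locally_minimal_group_topology :: "('a, 'b) monoid_scheme \<Rightarrow> 'a topology \<Rightarrow> bool" where
  "locally_minimal_group_topology G T \<longleftrightarrow>
     group_topology G T \<and> Hausdorff_space T \<and>
     (\<exists>U. neighbourhood_of T \<one>\<^bsub>G\<^esub> U \<and>
        (\<forall>T'. group_topology G T' \<and> Hausdorff_space T' \<and> weaker_topology T' T \<and>
              neighbourhood_of T' \<one>\<^bsub>G\<^esub> U \<longrightarrow> T' = T))"

end

theory Submission
  imports Defs
begin

text \<open>
  Let \<open>T\<close> be a non-discrete Hausdorff group topology on \<open>G\<close>, and \<open>U\<close> a neighbourhood of the identity. The
  idea is to weaken \<open>T\<close> strictly, keeping \<open>U\<close> a neighbourhood, by passing to a quotient of the completion: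
  if \<open>x\<close> is a torsion element of the completion of \<open>G\<close> such that the finite group \<open>\<langle>x\<rangle>\<close> lies close to the
  identity and meets \<open>G\<close> trivially, then \<open>G\<close> embeds into the completion modulo \<open>\<langle>x\<rangle>\<close>, and the topology
  induced from there is Hausdorff and weaker than \<open>T\<close>. It is strictly weaker, because elements of \<open>G\<close>
  that converge to \<open>x\<close> now converge to the identity.

  The proof finds \<open>x\<close> by a Baire category argument, carried out by hand inside \<open>G\<close>. Let \<open>p\<close> be the
  least positive exponent for which the subgroup \<open>{y. y [^] p = \<one>}\<close> is not discrete; it exists because
  \<open>n\<close> is such an exponent. Take \<open>x\<close> to be the formal limit of a sequence \<open>s k\<close> in this subgroup,
  together with identity neighbourhoods \<open>V k\<close> that bound how much the sequence may still move. Since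
  \<open>G\<close> is countable, stage \<open>k\<close> can make sure that no power \<open>x [^] j\<close> with \<open>j\<close> not divisible by \<open>p\<close> is the
  \<open>k\<close>-th element of \<open>G\<close>. Lemma \<open>next_partial_product\<close> does one such stage; it works since, by minimality
  of \<open>p\<close>, each equation \<open>(s \<otimes> y) [^] j = g\<close> with \<open>0 < j < p\<close> has at most one solution \<open>y\<close> in a small
  neighbourhood (\<open>finite_near_roots\<close>), while there are infinitely many candidates
  (\<open>infinite_torsion_near_one\<close>).

  The sets \<open>\<langle>s k\<rangle> \<otimes> V k\<close> play the part of the neighbourhoods of the identity modulo \<open>\<langle>x\<rangle>\<close>.
  They satisfy the axioms of a base, and \<open>exists_weaker_topology\<close> checks that the resulting topology
  has the properties above. Strictly speaking, \<open>x\<close> lives in the completion for the group topology with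
  base \<open>V k\<close> at the identity, which may already be weaker than \<open>T\<close>.

  Conversely, for the discrete topology \<open>U = {\<one>}\<close> is a witness of local minimality.
\<close>

section \<open>Group topologies given by a base at the identity\<close>

locale group_unit_base = comm_group G for G (structure) +
  fixes \<B> :: "'a set set"
  assumes base_nonempty: "\<B> \<noteq> {}"
    and base_carrier: "B \<in> \<B> \<Longrightarrow> B \<subseteq> carrier G"
    and base_one: "B \<in> \<B> \<Longrightarrow> \<one> \<in> B"
    and base_directed: "\<lbrakk>A \<in> \<B>; B \<in> \<B>\<rbrakk> \<Longrightarrow> \<exists>C\<in>\<B>. C \<subseteq> A \<inter> B"
    and base_div: "B \<in> \<B> \<Longrightarrow> \<exists>C\<in>\<B>. \<forall>x\<in>C. \<forall>y\<in>C. x \<otimes> inv y \<in> B"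
begin

definition base_topology :: "'a topology" where
  "base_topology = topology (\<lambda>A. A \<subseteq> carrier G \<and> (\<forall>a\<in>A. \<exists>B\<in>\<B>. \<forall>b\<in>B. a \<otimes> b \<in> A))"

lemma openin_base_topology:
  "openin base_topology A \<longleftrightarrow> A \<subseteq> carrier G \<and> (\<forall>a\<in>A. \<exists>B\<in>\<B>. \<forall>b\<in>B. a \<otimes> b \<in> A)"
proof -
  have "istopology (\<lambda>A. A \<subseteq> carrier G \<and> (\<forall>a\<in>A. \<exists>B\<in>\<B>. \<forall>b\<in>B. a \<otimes> b \<in> A))"
    unfolding istopology_def
  proof (rule conjI; (rule allI | rule impI)+)
    fix S S'
    assume S: "S \<subseteq> carrier G \<and> (\<forall>a\<in>S. \<exists>B\<in>\<B>. \<forall>b\<in>B. a \<otimes> b \<in> S)"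
      and S': "S' \<subseteq> carrier G \<and> (\<forall>a\<in>S'. \<exists>B\<in>\<B>. \<forall>b\<in>B. a \<otimes> b \<in> S')"
    have "\<exists>B\<in>\<B>. \<forall>b\<in>B. a \<otimes> b \<in> S \<inter> S'" if "a \<in> S \<inter> S'" for a
    proof -
      obtain B B' where "B \<in> \<B>" "\<forall>b\<in>B. a \<otimes> b \<in> S" "B' \<in> \<B>" "\<forall>b\<in>B'. a \<otimes> b \<in> S'"
        using S S' \<open>a \<in> S \<inter> S'\<close> by blast
      then show ?thesis
        using base_directed[of B B'] by blast
    qed
    then show "S \<inter> S' \<subseteq> carrier G \<and> (\<forall>a\<in>S \<inter> S'. \<exists>B\<in>\<B>. \<forall>b\<in>B. a \<otimes> b \<in> S \<inter> S')"
      using S by blast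
  next
    fix \<K>
    assume K: "\<forall>K\<in>\<K>. K \<subseteq> carrier G \<and> (\<forall>a\<in>K. \<exists>B\<in>\<B>. \<forall>b\<in>B. a \<otimes> b \<in> K)"
    have "\<exists>B\<in>\<B>. \<forall>b\<in>B. a \<otimes> b \<in> \<Union>\<K>" if "a \<in> \<Union>\<K>" for a
    proof -
      obtain K where "K \<in> \<K>" "a \<in> K"
        using \<open>a \<in> \<Union>\<K>\<close> by blast
      then obtain B where "B \<in> \<B>" "\<forall>b\<in>B. a \<otimes> b \<in> K"
        using K by blast
      then show ?thesis using \<open>K \<in> \<K>\<close> by blast
    qed
    then show "\<Union>\<K> \<subseteq> carrier G \<and> (\<forall>a\<in>\<Union>\<K>. \<exists>B\<in>\<B>. \<forall>b\<in>B. a \<otimes> b \<in> \<Union>\<K>)"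
      using K by (simp add: Sup_le_iff)
  qed
  then show ?thesis
    by (simp add: base_topology_def topology_inverse')
qed

lemma topspace_base_topology: "topspace base_topology = carrier G"
proof
  show "topspace base_topology \<subseteq> carrier G"
    using openin_base_topology openin_topspace by blast
  have "openin base_topology (carrier G)"
    unfolding openin_base_topology using base_nonempty base_carrier by blast
  then show "carrier G \<subseteq> topspace base_topology"
    by (rule openin_subset)
qed

lemma base_mult:
  assumes "B \<in> \<B>"
  shows "\<exists>C\<in>\<B>. \<forall>x\<in>C. \<forall>y\<in>C. x \<otimes> y \<in> B"
proof -
  obtain C where C: "C \<in> \<B>" "\<forall>x\<in>C. \<forall>y\<in>C. x \<otimes> inv y \<in> B"
    using base_div assms by blast
  obtain D where D: "D \<in> \<B>" "\<forall>x\<in>D. \<forall>y\<in>D. x \<otimes> inv y \<in> C"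
    using base_div C(1) by blast
  obtain E where E: "E \<in> \<B>" "E \<subseteq> C \<inter> D"
    using base_directed C(1) D(1) by blast
  have "x \<otimes> y \<in> B" if xy: "x \<in> E" "y \<in> E" for x y
  proof -
    have [simp]: "x \<in> carrier G" "y \<in> carrier G"
      using xy E(1) base_carrier by auto
    have "\<one> \<otimes> inv y \<in> C"
      using D E(2) xy base_one by blast
    then have "x \<otimes> inv (\<one> \<otimes> inv y) \<in> B"
      using C(2) E(2) xy by blast
    then show ?thesis by simp
  qed
  then show ?thesis using E(1) by blast
qed

text \<open>Members of the base need not be open, so a translate is replaced by its interior.\<close>

lemma open_inside_translate:
  assumes x: "x \<in> carrier G" and B: "B \<in> \<B>"
  shows "\<exists>A. openin base_topology A \<and> x \<in> A \<and> A \<subseteq> (\<lambda>b. x \<otimes> b) ` B"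
proof -
  define A where "A = {y \<in> carrier G. \<exists>C\<in>\<B>. \<forall>c\<in>C. y \<otimes> c \<in> (\<lambda>b. x \<otimes> b) ` B}"
  have "\<exists>D\<in>\<B>. \<forall>d\<in>D. y \<otimes> d \<in> A" if "y \<in> A" for y
  proof -
    obtain C where y: "y \<in> carrier G" and C: "C \<in> \<B>" "\<forall>c\<in>C. y \<otimes> c \<in> (\<lambda>b. x \<otimes> b) ` B"
      using \<open>y \<in> A\<close> A_def by blast
    obtain D where D: "D \<in> \<B>" "\<forall>u\<in>D. \<forall>v\<in>D. u \<otimes> v \<in> C"
      using base_mult C(1) by blast
    have "y \<otimes> d \<in> A" if d: "d \<in> D" for d
    proof -
      have dc: "d \<in> carrier G" using d D(1) base_carrier by blast
      have "\<forall>c\<in>D. (y \<otimes> d) \<otimes> c \<in> (\<lambda>b. x \<otimes> b) ` B"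
      proof
        fix c assume c: "c \<in> D"
        then have "c \<in> carrier G" using D(1) base_carrier by blast
        then have "(y \<otimes> d) \<otimes> c = y \<otimes> (d \<otimes> c)"
          using y dc by (simp add: m_assoc)
        then show "(y \<otimes> d) \<otimes> c \<in> (\<lambda>b. x \<otimes> b) ` B"
          using C(2) D(2) d c by simp
      qed
      then show ?thesis
        unfolding A_def using D(1) y dc by auto
    qed
    then show ?thesis using D(1) by blast
  qed
  then have "openin base_topology A"
    unfolding openin_base_topology by (auto simp: A_def)
  moreover have "x \<in> A"
    unfolding A_def using x B by blast
  moreover have "A \<subseteq> (\<lambda>b. x \<otimes> b) ` B"
  proof
    fix y assume "y \<in> A"
    then obtain C where "y \<in> carrier G" "C \<in> \<B>" "\<forall>c\<in>C. y \<otimes> c \<in> (\<lambda>b. x \<otimes> b) ` B"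
      unfolding A_def by blast
    then show "y \<in> (\<lambda>b. x \<otimes> b) ` B"
      using base_one by fastforce
  qed
  ultimately show ?thesis by blast
qed

lemma group_topology_base_topology: "group_topology G base_topology"
proof -
  have "continuous_map (prod_topology base_topology base_topology) base_topology (\<lambda>(x, y). x \<otimes> y)"
    unfolding continuous_map_def
  proof (intro conjI allI impI)
    fix A assume A: "openin base_topology A"
    show "openin (prod_topology base_topology base_topology)
            {z \<in> topspace (prod_topology base_topology base_topology). (case z of (x, y) \<Rightarrow> x \<otimes> y) \<in> A}"
      unfolding openin_prod_topology_alt
    proof (intro allI impI)
      fix x y
      assume "(x, y) \<in> {z \<in> topspace (prod_topology base_topology base_topology).
                        (case z of (x, y) \<Rightarrow> x \<otimes> y) \<in> A}"
      then have xy: "x \<in> carrier G" "y \<in> carrier G" "x \<otimes> y \<in> A"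
        by (auto simp: topspace_base_topology)
      then obtain B where B: "B \<in> \<B>" "\<forall>b\<in>B. x \<otimes> y \<otimes> b \<in> A"
        using A openin_base_topology by blast
      obtain C where C: "C \<in> \<B>" "\<forall>u\<in>C. \<forall>v\<in>C. u \<otimes> v \<in> B"
        using base_mult B(1) by blast
      obtain X Y where X: "openin base_topology X" "x \<in> X" "X \<subseteq> (\<lambda>b. x \<otimes> b) ` C"
        and Y: "openin base_topology Y" "y \<in> Y" "Y \<subseteq> (\<lambda>b. y \<otimes> b) ` C"
        using open_inside_translate[OF xy(1) C(1)] open_inside_translate[OF xy(2) C(1)] by auto
      have "u \<otimes> v \<in> A" if "u \<in> X" "v \<in> Y" for u v
      proof -
        obtain c d where cd: "c \<in> C" "d \<in> C" "u = x \<otimes> c" "v = y \<otimes> d"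
          using X(3) Y(3) \<open>u \<in> X\<close> \<open>v \<in> Y\<close> by blast
        moreover have "c \<in> carrier G" "d \<in> carrier G"
          using cd C(1) base_carrier by auto
        ultimately have "u \<otimes> v = x \<otimes> y \<otimes> (c \<otimes> d)"
          using xy by (simp add: m_ac)
        then show ?thesis using B(2) C(2) cd by simp
      qed
      moreover have "X \<subseteq> carrier G" "Y \<subseteq> carrier G"
        using X(1) Y(1) openin_base_topology by auto
      ultimately have "X \<times> Y \<subseteq> {z \<in> topspace (prod_topology base_topology base_topology).
                        (case z of (x, y) \<Rightarrow> x \<otimes> y) \<in> A}"
        by (auto simp: topspace_base_topology)
      then show "\<exists>X Y. openin base_topology X \<and> openin base_topology Y \<and> x \<in> X \<and> y \<in> Y \<and>
          X \<times> Y \<subseteq> {z \<in> topspace (prod_topology base_topology base_topology).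
                        (case z of (x, y) \<Rightarrow> x \<otimes> y) \<in> A}"
        using X Y by blast
    qed
  qed (auto simp: topspace_base_topology)
  moreover have "continuous_map base_topology base_topology (\<lambda>x. inv x)"
    unfolding continuous_map_def
  proof (intro conjI allI impI)
    fix A assume A: "openin base_topology A"
    show "openin base_topology {x \<in> topspace base_topology. inv x \<in> A}"
      unfolding openin_base_topology topspace_base_topology
    proof (intro conjI ballI)
      fix x assume "x \<in> {x \<in> carrier G. inv x \<in> A}"
      then have x: "x \<in> carrier G" "inv x \<in> A" by auto
      then obtain B where B: "B \<in> \<B>" "\<forall>b\<in>B. inv x \<otimes> b \<in> A"
        using A openin_base_topology by blast
      obtain C where C: "C \<in> \<B>" "\<forall>u\<in>C. \<forall>v\<in>C. u \<otimes> inv v \<in> B"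
        using base_div B(1) by blast
      have "x \<otimes> c \<in> {x \<in> carrier G. inv x \<in> A}" if c: "c \<in> C" for c
      proof -
        have cc: "c \<in> carrier G" using c C(1) base_carrier by blast
        have "\<one> \<otimes> inv c \<in> B" using C base_one c by blast
        then have "inv x \<otimes> inv c \<in> A" using B(2) cc by simp
        then show ?thesis using x(1) cc by (simp add: inv_mult)
      qed
      then show "\<exists>B\<in>\<B>. \<forall>b\<in>B. x \<otimes> b \<in> {x \<in> carrier G. inv x \<in> A}"
        using C(1) by blast
    qed auto
  qed (auto simp: topspace_base_topology)
  ultimately show ?thesis
    by (simp add: group_topology_def topspace_base_topology)
qed

lemma Hausdorff_base_topology:
  assumes "\<And>x. \<lbrakk>x \<in> carrier G; x \<noteq> \<one>\<rbrakk> \<Longrightarrow> \<exists>B\<in>\<B>. x \<notin> B"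
  shows "Hausdorff_space base_topology"
  unfolding Hausdorff_space_def topspace_base_topology
proof (intro allI impI, elim conjE)
  fix x y assume x: "x \<in> carrier G" and y: "y \<in> carrier G" and "x \<noteq> y"
  then have "inv x \<otimes> y \<noteq> \<one>"
    using inv_solve_left'[of \<one> x y] by simp
  then obtain B where B: "B \<in> \<B>" "inv x \<otimes> y \<notin> B"
    using assms x y by blast
  obtain C where C: "C \<in> \<B>" "\<forall>u\<in>C. \<forall>v\<in>C. u \<otimes> inv v \<in> B"
    using base_div B(1) by blast
  obtain X Y where X: "openin base_topology X" "x \<in> X" "X \<subseteq> (\<lambda>b. x \<otimes> b) ` C"
    and Y: "openin base_topology Y" "y \<in> Y" "Y \<subseteq> (\<lambda>b. y \<otimes> b) ` C"
    using open_inside_translate[OF x C(1)] open_inside_translate[OF y C(1)] by auto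
  have "x \<otimes> c \<noteq> y \<otimes> d" if cd: "c \<in> C" "d \<in> C" for c d
  proof
    assume eq: "x \<otimes> c = y \<otimes> d"
    have cc: "c \<in> carrier G" "d \<in> carrier G" using cd C(1) base_carrier by auto
    have "inv x \<otimes> y = inv x \<otimes> (y \<otimes> d) \<otimes> inv d"
      using x y cc by (simp add: m_assoc)
    also have "\<dots> = c \<otimes> inv d"
      using x cc by (simp add: eq[symmetric] m_assoc[symmetric])
    finally show False using B(2) C(2) cd by simp
  qed
  then have "disjnt X Y"
    using X(3) Y(3) unfolding disjnt_def by blast
  then show "\<exists>U V. openin base_topology U \<and> openin base_topology V \<and> x \<in> U \<and> y \<in> V \<and> disjnt U V"
    using X Y by blast
qed

lemma neighbourhood_of_base_topology:
  assumes "B \<in> \<B>" "B \<subseteq> U" "U \<subseteq> carrier G"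
  shows "neighbourhood_of base_topology \<one> U"
proof -
  obtain A where A: "openin base_topology A" "\<one> \<in> A" "A \<subseteq> (\<lambda>b. \<one> \<otimes> b) ` B"
    using open_inside_translate[OF one_closed assms(1)] by blast
  moreover have "(\<lambda>b. \<one> \<otimes> b) ` B = B"
    using base_carrier[OF assms(1)] by force
  ultimately show ?thesis
    unfolding neighbourhood_of_def topspace_base_topology using assms by auto
qed

end

section \<open>Neighbourhoods of the identity in a Hausdorff abelian group\<close>

locale Hausdorff_comm_group = comm_group G for G (structure) +
  fixes T :: "'a topology"
  assumes group_top: "group_topology G T" and Hausdorff: "Hausdorff_space T"
begin

definition unit_nbhd :: "'a set \<Rightarrow> bool" where
  "unit_nbhd V \<longleftrightarrow> openin T V \<and> \<one> \<in> V"

lemma topspace_eq: "topspace T = carrier G"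
  using group_top by (simp add: group_topology_def)

lemma unit_nbhd_carrier: "unit_nbhd V \<Longrightarrow> x \<in> V \<Longrightarrow> x \<in> carrier G"
  unfolding unit_nbhd_def using openin_subset topspace_eq by blast

lemma unit_nbhd_Int: "unit_nbhd V \<Longrightarrow> unit_nbhd W \<Longrightarrow> unit_nbhd (V \<inter> W)"
  unfolding unit_nbhd_def by blast

lemma unit_nbhd_UNIV: "unit_nbhd (carrier G)"
  unfolding unit_nbhd_def using openin_topspace topspace_eq by (metis one_closed)

text \<open>
  The identity is always kept, so that a finite set of values to be avoided can be removed without
  knowing whether the identity is among them.
\<close>

lemma unit_nbhd_remove_finite:
  assumes "unit_nbhd V" "finite F"
  shows "unit_nbhd (V - (F - {\<one>}))"
proof -
  have "closedin T ((F - {\<one>}) \<inter> topspace T)"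
    using assms(2) Hausdorff by (auto intro: closedin_Hausdorff_finite)
  then have "openin T (V - (F - {\<one>}) \<inter> topspace T)"
    using assms(1) unit_nbhd_def by blast
  moreover have "V - (F - {\<one>}) \<inter> topspace T = V - (F - {\<one>})"
    using assms(1) openin_subset unfolding unit_nbhd_def by fastforce
  ultimately show ?thesis
    using assms(1) by (simp add: unit_nbhd_def)
qed

lemma unit_nbhd_div:
  assumes "unit_nbhd V"
  shows "\<exists>W. unit_nbhd W \<and> (\<forall>x\<in>W. \<forall>y\<in>W. x \<otimes> inv y \<in> V)"
proof -
  define P where "P = {z \<in> topspace (prod_topology T T). (case z of (x, y) \<Rightarrow> x \<otimes> y) \<in> V}"
  have "openin (prod_topology T T) P"
    unfolding P_def using group_top assms unfolding group_topology_def unit_nbhd_def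
    by (blast intro: openin_continuous_map_preimage)
  moreover have "(\<one>, \<one>) \<in> P"
    using assms by (simp add: P_def topspace_eq unit_nbhd_def)
  ultimately obtain X Y where XY: "openin T X" "openin T Y" "\<one> \<in> X" "\<one> \<in> Y" "X \<times> Y \<subseteq> P"
    using openin_prod_topology_alt[of T T P] by metis
  let ?Y = "{y \<in> topspace T. inv y \<in> Y}"
  have "openin T ?Y"
    using group_top XY(2) unfolding group_topology_def
    by (blast intro: openin_continuous_map_preimage)
  then have "unit_nbhd (X \<inter> ?Y)"
    using XY by (auto simp: unit_nbhd_def topspace_eq)
  moreover have "\<forall>x\<in>X \<inter> ?Y. \<forall>y\<in>X \<inter> ?Y. x \<otimes> inv y \<in> V"
    using XY(5) by (auto simp: P_def)
  ultimately show ?thesis by blast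
qed

lemma unit_nbhd_mult_div:
  assumes "unit_nbhd V"
  shows "\<exists>W. unit_nbhd W \<and> (\<forall>x\<in>W. \<forall>y\<in>W. \<forall>z\<in>W. x \<otimes> y \<otimes> inv z \<in> V)"
proof -
  obtain W where W: "unit_nbhd W" "\<forall>x\<in>W. \<forall>y\<in>W. x \<otimes> inv y \<in> V"
    using unit_nbhd_div assms by blast
  obtain W' where W': "unit_nbhd W'" "\<forall>x\<in>W'. \<forall>y\<in>W'. x \<otimes> inv y \<in> W"
    using unit_nbhd_div W(1) by blast
  have "x \<otimes> y \<otimes> inv z \<in> V" if "x \<in> W \<inter> W'" "y \<in> W \<inter> W'" "z \<in> W \<inter> W'" for x y z
  proof -
    have c: "x \<in> carrier G" "y \<in> carrier G" "z \<in> carrier G"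
      using that W(1) unit_nbhd_carrier by auto
    have "x \<otimes> inv (z \<otimes> inv y) \<in> V"
      using W(2) W'(2) that by blast
    also have "x \<otimes> inv (z \<otimes> inv y) = x \<otimes> y \<otimes> inv z"
      using c by (simp add: inv_mult m_ac)
    finally show ?thesis .
  qed
  with unit_nbhd_Int[OF W(1) W'(1)] show ?thesis
    by (intro exI[of _ "W \<inter> W'"] conjI ballI)
qed

lemma unit_nbhd_pow:
  assumes "unit_nbhd V"
  shows "\<exists>W. unit_nbhd W \<and> (\<forall>x\<in>W. \<forall>j<q::nat. x [^] j \<in> V)"
  using assms
proof (induction q arbitrary: V)
  case 0
  then show ?case by blast
next
  case (Suc q)
  obtain W where W: "unit_nbhd W" "\<forall>x\<in>W. \<forall>y\<in>W. \<forall>z\<in>W. x \<otimes> y \<otimes> inv z \<in> V"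
    using unit_nbhd_mult_div Suc.prems by blast
  obtain W' where W': "unit_nbhd W'" "\<forall>x\<in>W'. \<forall>j<q. x [^] j \<in> W"
    using Suc.IH W(1) by blast
  have "x [^] j \<in> V" if x: "x \<in> W \<inter> W'" and j: "j < Suc q" for x j
  proof (cases j)
    case 0
    then show ?thesis using Suc.prems by (simp add: unit_nbhd_def)
  next
    case (Suc i)
    have xc: "x \<in> carrier G" using x W(1) unit_nbhd_carrier by blast
    have "x [^] i \<in> W" "x \<in> W" "\<one> \<in> W"
      using W(1) W'(2) x j Suc unfolding unit_nbhd_def by auto
    then have "x [^] i \<otimes> x \<otimes> inv \<one> \<in> V"
      using W(2) by blast
    then show ?thesis using xc Suc by simp
  qed
  with unit_nbhd_Int[OF W(1) W'(1)] show ?case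
    by (intro exI[of _ "W \<inter> W'"] conjI ballI allI impI)
qed

lemma continuous_translate:
  assumes "a \<in> carrier G"
  shows "continuous_map T T (\<lambda>x. a \<otimes> x)"
proof -
  have "continuous_map T (prod_topology T T) (\<lambda>x. (a, x))"
    using assms by (auto simp: continuous_map_pairedI topspace_eq)
  then have "continuous_map T T ((\<lambda>(x, y). x \<otimes> y) \<circ> (\<lambda>x. (a, x)))"
    using group_top continuous_map_compose unfolding group_topology_def by blast
  then show ?thesis by (simp add: o_def)
qed

lemma openin_translate:
  assumes "openin T V" "a \<in> carrier G"
  shows "openin T ((\<lambda>x. a \<otimes> x) ` V)"
proof -
  have V: "V \<subseteq> carrier G" using assms(1) openin_subset topspace_eq by blast
  have "openin T {x \<in> topspace T. inv a \<otimes> x \<in> V}"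
    using continuous_translate[of "inv a"] assms by (auto intro: openin_continuous_map_preimage)
  also have "{x \<in> topspace T. inv a \<otimes> x \<in> V} = (\<lambda>x. a \<otimes> x) ` V"
  proof (intro equalityI subsetI)
    fix x assume "x \<in> {x \<in> topspace T. inv a \<otimes> x \<in> V}"
    moreover from this have "x = a \<otimes> (inv a \<otimes> x)"
      using assms(2) by (simp add: topspace_eq m_assoc[symmetric])
    ultimately show "x \<in> (\<lambda>x. a \<otimes> x) ` V" by blast
  next
    fix x assume "x \<in> (\<lambda>x. a \<otimes> x) ` V"
    then show "x \<in> {x \<in> topspace T. inv a \<otimes> x \<in> V}"
      using V assms(2) by (auto simp: topspace_eq m_assoc[symmetric])
  qed
  finally show ?thesis .
qed

lemma discrete_if_open_one:
  assumes "openin T {\<one>}"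
  shows "T = discrete_topology (carrier G)"
proof -
  have "openin T {a}" if "a \<in> carrier G" for a
    using openin_translate[OF assms that] that by simp
  then show ?thesis
    using discrete_topology_unique[of "carrier G" T] topspace_eq by simp
qed

section \<open>Torsion near the identity\<close>

definition nondiscrete_torsion :: "nat \<Rightarrow> bool" where
  "nondiscrete_torsion q \<longleftrightarrow> (\<forall>V. unit_nbhd V \<longrightarrow> (\<exists>y\<in>V. y \<noteq> \<one> \<and> y [^] q = \<one>))"

text \<open>
  In a Hausdorff space a finite set of nontrivial torsion elements could be cut away from the
  neighbourhood.
\<close>

lemma infinite_torsion_near_one:
  assumes "nondiscrete_torsion q" "unit_nbhd V"
  shows "infinite {y \<in> V. y [^] q = \<one>}"
proof
  assume "finite {y \<in> V. y [^] q = \<one>}"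
  then have "unit_nbhd (V - ({y \<in> V. y [^] q = \<one>} - {\<one>}))"
    using unit_nbhd_remove_finite assms(2) by blast
  then show False
    using assms(1) unfolding nondiscrete_torsion_def by blast
qed

lemma discrete_torsion_uniform:
  assumes "\<And>j. 0 < j \<Longrightarrow> j < q \<Longrightarrow> \<not> nondiscrete_torsion j"
  shows "\<exists>D. unit_nbhd D \<and> (\<forall>j y. 0 < j \<longrightarrow> j < q \<longrightarrow> y \<in> D \<longrightarrow> y [^] j = \<one> \<longrightarrow> y = \<one>)"
  using assms
proof (induction q)
  case 0
  then show ?case using unit_nbhd_UNIV by auto
next
  case (Suc q)
  then obtain D where D: "unit_nbhd D"
    "\<And>j y. \<lbrakk>0 < j; j < q; y \<in> D; y [^] j = \<one>\<rbrakk> \<Longrightarrow> y = \<one>"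
    by (metis less_SucI)
  show ?case
  proof (cases "q = 0")
    case True
    then show ?thesis using unit_nbhd_UNIV by auto
  next
    case False
    then obtain E where E: "unit_nbhd E" "\<And>y. \<lbrakk>y \<in> E; y [^] q = \<one>\<rbrakk> \<Longrightarrow> y = \<one>"
      using Suc.prems[of q] unfolding nondiscrete_torsion_def by auto
    have "y = \<one>" if "0 < j" "j < Suc q" "y \<in> D \<inter> E" "y [^] j = \<one>" for j y
      using that D(2) E(2) by (cases "j = q") auto
    with unit_nbhd_Int[OF D(1) E(1)] show ?thesis
      by (intro exI[of _ "D \<inter> E"] conjI allI impI)
  qed
qed

lemma int_pow_torsion_mod:
  assumes "x \<in> carrier G" "x [^] p = \<one>" "0 < p"
  shows "x [^] (j::int) = x [^] nat (j mod int p)"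
proof -
  have "x [^] j = x [^] (int p * (j div int p) + j mod int p)" by simp
  also have "\<dots> = (x [^] int p) [^] (j div int p) \<otimes> x [^] (j mod int p)"
    using assms(1) by (simp only: int_pow_mult int_pow_pow)
  also have "\<dots> = x [^] (j mod int p)"
    using assms by (simp add: int_pow_int)
  also have "\<dots> = x [^] nat (j mod int p)"
    using assms(3) by (simp add: int_pow_int[symmetric])
  finally show ?thesis .
qed

text \<open>
  Two solutions of \<open>(s \<otimes> y) [^] j = g\<close> differ by an element of exponent \<open>j\<close>. If both are near the
  identity, so is their quotient, which is then trivial because the elements of exponent \<open>j < p\<close> form a
  discrete subgroup.
\<close>

lemma finite_near_roots:
  assumes q: "\<And>j. 0 < j \<Longrightarrow> j < p \<Longrightarrow> \<not> nondiscrete_torsion j" and s: "s \<in> carrier G"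
  shows "\<exists>D. unit_nbhd D \<and> finite {y \<in> D. \<exists>j. 0 < j \<and> j < p \<and> (s \<otimes> y) [^] j = g}"
proof -
  obtain D where D: "unit_nbhd D"
    "\<And>j y. \<lbrakk>0 < j; j < p; y \<in> D; y [^] j = \<one>\<rbrakk> \<Longrightarrow> y = \<one>"
    using discrete_torsion_uniform[OF q] by blast
  obtain E where E: "unit_nbhd E" "\<forall>x\<in>E. \<forall>y\<in>E. x \<otimes> inv y \<in> D"
    using unit_nbhd_div D(1) by blast
  have fin: "finite {y \<in> E. (s \<otimes> y) [^] j = g}" if j: "0 < j" "j < p" for j
  proof -
    have "x = y" if x: "x \<in> E" "(s \<otimes> x) [^] j = g" and y: "y \<in> E" "(s \<otimes> y) [^] j = g" for x y
    proof -
      have c: "x \<in> carrier G" "y \<in> carrier G"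
        using x(1) y(1) E(1) unit_nbhd_carrier by auto
      have "s [^] j \<otimes> x [^] j = s [^] j \<otimes> y [^] j"
        using x(2) y(2) c s by (simp add: nat_pow_distrib)
      then have "x [^] j = y [^] j"
        using c s by simp
      then have "(x \<otimes> inv y) [^] j = \<one>"
        using c by (simp add: nat_pow_distrib nat_pow_inv)
      then have "x \<otimes> inv y = \<one>"
        using D(2) E(2) j x(1) y(1) by blast
      then show ?thesis
        using inv_solve_right'[of \<one> x y] c by auto
    qed
    then have "\<exists>z. {y \<in> E. (s \<otimes> y) [^] j = g} \<subseteq> {z}" by blast
    then show ?thesis using finite_subset by blast
  qed
  have "{y \<in> E. \<exists>j. 0 < j \<and> j < p \<and> (s \<otimes> y) [^] j = g} =
        (\<Union>j\<in>{0<..<p}. {y \<in> E. (s \<otimes> y) [^] j = g})" by auto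
  then have "finite {y \<in> E. \<exists>j. 0 < j \<and> j < p \<and> (s \<otimes> y) [^] j = g}"
    using fin by auto
  then show ?thesis using E(1) by blast
qed

section \<open>A sequence that is made to converge to the identity\<close>

text \<open>
  One stage of the recursion, from \<open>(V, s)\<close> to \<open>(W, t)\<close>. The first condition on \<open>W\<close> and \<open>t\<close> yields both
  that the sequence is Cauchy and that the sets \<open>\<langle>s\<rangle> \<otimes> V\<close> are compatible with division. The second one
  separates \<open>g\<close> from \<open>\<langle>t\<rangle> \<otimes> W\<close> if \<open>g \<noteq> \<one>\<close>; for \<open>g = \<one>\<close> it keeps the nontrivial powers of \<open>t\<close> away from
  the identity, so that the limit of the sequence is nontrivial.
\<close>

lemma next_partial_product:
  assumes p: "nondiscrete_torsion p" "0 < p"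
    and least: "\<And>j. 0 < j \<Longrightarrow> j < p \<Longrightarrow> \<not> nondiscrete_torsion j"
    and V: "unit_nbhd V" and s: "s \<in> carrier G" "s [^] p = \<one>" and g: "g \<in> carrier G"
  shows "\<exists>W t. unit_nbhd W \<and> t \<in> carrier G \<and> t [^] p = \<one> \<and>
           (\<forall>j::int. \<forall>v\<in>W. \<forall>w\<in>W. (t \<otimes> inv s) [^] j \<otimes> v \<otimes> inv w \<in> V) \<and>
           (\<forall>j::int. \<forall>v\<in>W. t [^] j \<otimes> v = g \<longrightarrow> g = \<one> \<and> int p dvd j)"
proof -
  obtain W where W: "unit_nbhd W" "\<forall>x\<in>W. \<forall>y\<in>W. \<forall>z\<in>W. x \<otimes> y \<otimes> inv z \<in> V"
    using unit_nbhd_mult_div V by blast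
  obtain P where P: "unit_nbhd P" "\<forall>x\<in>P. \<forall>j<p. x [^] j \<in> W"
    using unit_nbhd_pow W(1) by blast
  obtain D where D: "unit_nbhd D" "finite {y \<in> D. \<exists>j. 0 < j \<and> j < p \<and> (s \<otimes> y) [^] j = g}"
    using finite_near_roots[OF least s(1)] by blast
  have "infinite {y \<in> P \<inter> D. y [^] p = \<one>}"
    using infinite_torsion_near_one p(1) unit_nbhd_Int P(1) D(1) by blast
  then have "\<not> {y \<in> P \<inter> D. y [^] p = \<one>} \<subseteq> {y \<in> D. \<exists>j. 0 < j \<and> j < p \<and> (s \<otimes> y) [^] j = g}"
    using D(2) finite_subset by blast
  then obtain y where y: "y \<in> P" "y [^] p = \<one>"
    and y_avoids: "\<And>j. \<lbrakk>0 < j; j < p\<rbrakk> \<Longrightarrow> (s \<otimes> y) [^] j \<noteq> g"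
    by blast
  have yc: "y \<in> carrier G" using y P(1) unit_nbhd_carrier by blast
  define t where "t = s \<otimes> y"
  have t: "t \<in> carrier G" "t [^] p = \<one>"
    using s y yc by (simp_all add: t_def nat_pow_distrib)
  have quot: "t \<otimes> inv s = y"
    using s(1) yc by (simp add: t_def m_comm m_assoc[symmetric])
  \<comment> \<open>The values of \<open>v\<close> that solve \<open>t [^] j \<otimes> v = g\<close>. For \<open>0 < j < p\<close> they differ from \<open>\<one>\<close> by the choice
      of \<open>y\<close>, so they can be removed from \<open>W\<close>; for \<open>j = 0\<close> the value is \<open>g\<close> itself.\<close>
  define F where "F = insert g ((\<lambda>j. inv (t [^] j) \<otimes> g) ` {j::nat. 0 < j \<and> j < p})"
  define W' where "W' = W - (F - {\<one>})"
  have "finite F" by (simp add: F_def)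
  then have W': "unit_nbhd W'"
    unfolding W'_def using W(1) by (rule unit_nbhd_remove_finite[rotated])
  have small: "(t \<otimes> inv s) [^] j \<otimes> v \<otimes> inv w \<in> V" if "v \<in> W'" "w \<in> W'" for j :: int and v w
  proof -
    have "nat (j mod int p) < p"
      using p(2) by (simp add: nat_less_iff)
    then have "y [^] j \<in> W"
      using P(2) y(1) int_pow_torsion_mod[OF yc y(2) p(2), of j] by metis
    then show ?thesis
      using W(2) that by (simp add: quot W'_def)
  qed
  have avoid: "g = \<one> \<and> int p dvd j" if v: "v \<in> W'" and eq: "t [^] j \<otimes> v = g" for j :: int and v
  proof -
    define i where "i = nat (j mod int p)"
    have i: "i < p"
      using p(2) by (simp add: i_def nat_less_iff)
    have tj: "t [^] j = t [^] i"
      unfolding i_def by (rule int_pow_torsion_mod[OF t p(2)])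
    have vc: "v \<in> carrier G" using v W' unit_nbhd_carrier by blast
    have v_eq: "v = inv (t [^] i) \<otimes> g"
      using eq vc t(1) by (simp add: tj m_assoc[symmetric] eq[symmetric])
    have "i = 0"
    proof (rule ccontr)
      assume "i \<noteq> 0"
      then have "v \<in> F" using i v_eq by (auto simp: F_def)
      then have "v = \<one>" using v by (auto simp: W'_def)
      then have "t [^] i = g" using eq tj t(1) by simp
      then show False using y_avoids[of i] i \<open>i \<noteq> 0\<close> by (simp add: t_def)
    qed
    then have "v = g" using eq vc by (simp add: tj)
    then have "g = \<one>" using v by (auto simp: W'_def F_def)
    moreover have "int p dvd j"
      using \<open>i = 0\<close> p(2) unfolding i_def
      by (metis Euclidean_Rings.pos_mod_sign mod_eq_0_iff_dvd nat_0_iff of_nat_0_less_iff order_antisym)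
    ultimately show ?thesis by blast
  qed
  show ?thesis using W' t small avoid by blast
qed

text \<open>
  The new base consists of the sets \<open>B k = \<langle>s k\<rangle> \<otimes> V k\<close>. The sequence \<open>s\<close> tends to the identity in the
  new topology, because \<open>s k \<in> B k\<close>, but not in \<open>T\<close>.
\<close>

lemma exists_weaker_topology:
  fixes n :: nat
  assumes count: "countable (carrier G)"
    and n: "0 < n" "\<And>x. x \<in> carrier G \<Longrightarrow> x [^] n = \<one>"
    and nondiscrete: "T \<noteq> discrete_topology (carrier G)"
    and U: "neighbourhood_of T \<one> U"
  shows "\<exists>T'. group_topology G T' \<and> Hausdorff_space T' \<and> weaker_topology T' T \<and>
              neighbourhood_of T' \<one> U \<and> T' \<noteq> T"
proof -
  have "nondiscrete_torsion n"
    unfolding nondiscrete_torsion_def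
  proof (intro allI impI)
    fix V assume V: "unit_nbhd V"
    have "V \<noteq> {\<one>}"
      using V nondiscrete discrete_if_open_one unit_nbhd_def by auto
    then show "\<exists>y\<in>V. y \<noteq> \<one> \<and> y [^] n = \<one>"
      using V n(2) unit_nbhd_carrier unfolding unit_nbhd_def by blast
  qed
  define p where "p = (LEAST q. 0 < q \<and> nondiscrete_torsion q)"
  have "0 < p \<and> nondiscrete_torsion p"
    unfolding p_def using \<open>nondiscrete_torsion n\<close> n(1)
    by (intro LeastI[of "\<lambda>q. 0 < q \<and> nondiscrete_torsion q" n]) simp
  then have p: "0 < p" "nondiscrete_torsion p" by auto
  have least: "\<not> nondiscrete_torsion j" if "0 < j" "j < p" for j
    using not_less_Least that unfolding p_def by blast
  have "\<not> nondiscrete_torsion 1"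
    unfolding nondiscrete_torsion_def using unit_nbhd_UNIV by auto
  then have "p \<noteq> 1" using p(2) by auto
  define e where "e = from_nat_into (carrier G)"
  have e: "e k \<in> carrier G" for k
    unfolding e_def by (rule from_nat_into) auto
  have e_surj: "\<exists>k. e k = x" if "x \<in> carrier G" for x
    unfolding e_def using from_nat_into_surj[OF count that] .
  obtain V0 where V0: "unit_nbhd V0" "V0 \<subseteq> U"
    using U unfolding neighbourhood_of_def unit_nbhd_def by blast
  let ?Inv = "\<lambda>(V, s). unit_nbhd V \<and> s \<in> carrier G \<and> s [^] p = \<one>"
  let ?Step = "\<lambda>k (V, s) (W, t).
        (\<forall>j::int. \<forall>v\<in>W. \<forall>w\<in>W. (t \<otimes> inv s) [^] j \<otimes> v \<otimes> inv w \<in> V) \<and>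
        (\<forall>j::int. \<forall>v\<in>W. t [^] j \<otimes> v = e k \<longrightarrow> e k = \<one> \<and> int p dvd j)"
  \<comment> \<open>Starting from \<open>s 0 = \<one>\<close> and \<open>V 0 \<subseteq> U\<close> makes the first member of the new base a subset of \<open>U\<close>.\<close>
  have "\<exists>f. \<forall>k. (?Inv (f k) \<and> (k = 0 \<longrightarrow> f k = (V0, \<one>))) \<and> ?Step k (f k) (f (Suc k))"
  proof (rule dependent_nat_choice[where P = "\<lambda>k x. ?Inv x \<and> (k = 0 \<longrightarrow> x = (V0, \<one>))"
              and Q = ?Step])
    show "\<exists>x. ?Inv x \<and> (0 = (0::nat) \<longrightarrow> x = (V0, \<one>))"
      using V0(1) by auto
    show "\<exists>y. (?Inv y \<and> (Suc k = 0 \<longrightarrow> y = (V0, \<one>))) \<and> ?Step k x y"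
      if "?Inv x \<and> (k = 0 \<longrightarrow> x = (V0, \<one>))" for x k
    proof -
      obtain V s where x: "x = (V, s)" by (cases x)
      show ?thesis
        using next_partial_product[OF p(2,1) least, of V s "e k"] that e[of k]
        unfolding x by auto
    qed
  qed
  then obtain f where "\<forall>k. (?Inv (f k) \<and> (k = 0 \<longrightarrow> f k = (V0, \<one>))) \<and> ?Step k (f k) (f (Suc k))"
    by (rule exE)
  then have f: "\<And>k. ?Inv (f k)" "f 0 = (V0, \<one>)" "\<And>k. ?Step k (f k) (f (Suc k))"
    by simp_all
  define V where "V = fst \<circ> f"
  define s where "s = snd \<circ> f"
  have V: "unit_nbhd (V k)" and s: "s k \<in> carrier G" for k
    using f(1)[of k] by (auto simp: V_def s_def split_beta)
  have s_step: "s (Suc k) = s k \<otimes> (s (Suc k) \<otimes> inv (s k))" for k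
    using s by (simp add: m_lcomm[of "s k"])
  have zero: "V 0 = V0" "s 0 = \<one>"
    using f(2) by (simp_all add: V_def s_def)
  have small: "(s (Suc k) \<otimes> inv (s k)) [^] j \<otimes> v \<otimes> inv w \<in> V k"
    if "v \<in> V (Suc k)" "w \<in> V (Suc k)" for k and j :: int and v w
    using f(3)[of k] that by (auto simp: V_def s_def split_beta)
  have avoid: "e k = \<one> \<and> int p dvd j"
    if "v \<in> V (Suc k)" "s (Suc k) [^] j \<otimes> v = e k" for k and j :: int and v
    using f(3)[of k] that by (auto simp: V_def s_def split_beta)
  have Vc: "v \<in> carrier G" if "v \<in> V k" for v k
    using V that unit_nbhd_carrier by blast
  have one_V: "\<one> \<in> V k" for k
    using V unit_nbhd_def by blast

  define B where "B k = {s k [^] j \<otimes> v | (j::int) v. v \<in> V k}" for k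
  have V_sub_B: "V k \<subseteq> B k" for k
  proof
    fix v assume v: "v \<in> V k"
    then have "v = s k [^] (0::int) \<otimes> v" using Vc by simp
    then show "v \<in> B k" unfolding B_def using v by blast
  qed
  have B_div: "x \<otimes> inv y \<in> B k" if xy: "x \<in> B (Suc k)" "y \<in> B (Suc k)" for x y k
  proof -
    define a where "a = s (Suc k) \<otimes> inv (s k)"
    have ac: "a \<in> carrier G" using s by (simp add: a_def)
    have sa: "s (Suc k) = s k \<otimes> a"
      unfolding a_def by (rule s_step)
    obtain i j :: int and v w where x: "x = s (Suc k) [^] i \<otimes> v" and y: "y = s (Suc k) [^] j \<otimes> w"
      and vw: "v \<in> V (Suc k)" "w \<in> V (Suc k)"
      using xy unfolding B_def by blast
    have "x \<otimes> inv y = s (Suc k) [^] (i - j) \<otimes> (v \<otimes> inv w)"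
      unfolding x y using s vw Vc by (simp add: int_pow_diff inv_mult m_ac)
    also have "\<dots> = s k [^] (i - j) \<otimes> (a [^] (i - j) \<otimes> v \<otimes> inv w)"
      unfolding sa using s ac vw Vc by (simp add: int_pow_distrib m_assoc)
    finally show ?thesis
      unfolding B_def using small[OF vw, of "i - j"] by (auto simp: a_def)
  qed
  have one_B: "\<one> \<in> B k" for k using V_sub_B one_V by blast
  have Bc: "B k \<subseteq> carrier G" for k
    unfolding B_def using s Vc by auto
  have "B (Suc k) \<subseteq> B k" for k
  proof
    fix x assume "x \<in> B (Suc k)"
    then show "x \<in> B k"
      using B_div[of x k \<one>] one_B Bc[of "Suc k"] by auto
  qed
  then have B_mono: "B m \<subseteq> B k" if "k \<le> m" for k m
    using that by (rule lift_Suc_antimono_le)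
  interpret base: group_unit_base G "range B"
  proof
    show "C \<subseteq> carrier G" if "C \<in> range B" for C using that Bc by auto
    show "\<one> \<in> C" if "C \<in> range B" for C using that one_B by auto
    show "\<exists>E\<in>range B. E \<subseteq> C \<inter> D" if CD: "C \<in> range B" "D \<in> range B" for C D
    proof -
      obtain k m where "C = B k" "D = B m" using CD by blast
      then have "B (max k m) \<subseteq> C \<inter> D" using B_mono by simp
      then show ?thesis by blast
    qed
    show "\<exists>D\<in>range B. \<forall>x\<in>D. \<forall>y\<in>D. x \<otimes> inv y \<in> C" if "C \<in> range B" for C
      using that B_div by blast
  qed auto
  let ?T' = base.base_topology
  have "Hausdorff_space ?T'"
  proof (rule base.Hausdorff_base_topology)
    fix x assume x: "x \<in> carrier G" "x \<noteq> \<one>"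
    then obtain k where k: "e k = x" using e_surj by blast
    have "x \<notin> B (Suc k)"
    proof
      assume "x \<in> B (Suc k)"
      then obtain j :: int and v where "v \<in> V (Suc k)" "s (Suc k) [^] j \<otimes> v = e k"
        unfolding B_def k by blast
      then show False using avoid k x(2) by blast
    qed
    then show "\<exists>C\<in>range B. x \<notin> C" by blast
  qed
  moreover have "weaker_topology ?T' T"
    unfolding weaker_topology_def
  proof (intro allI impI)
    fix A assume A: "openin ?T' A"
    show "openin T A"
    proof (subst openin_subopen, intro ballI)
      fix a assume a: "a \<in> A"
      then have ac: "a \<in> carrier G"
        using A base.openin_base_topology by blast
      obtain k where k: "\<forall>b\<in>B k. a \<otimes> b \<in> A"
        using A a base.openin_base_topology by blast
      have "openin T ((\<lambda>x. a \<otimes> x) ` V k)"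
        using openin_translate[OF _ ac] V unit_nbhd_def by blast
      moreover have "a \<in> (\<lambda>x. a \<otimes> x) ` V k"
        using ac one_V[of k] by (metis image_eqI r_one)
      moreover have "(\<lambda>x. a \<otimes> x) ` V k \<subseteq> A"
        using k V_sub_B by blast
      ultimately show "\<exists>X. openin T X \<and> a \<in> X \<and> X \<subseteq> A" by blast
    qed
  qed
  moreover have "neighbourhood_of ?T' \<one> U"
  proof (rule base.neighbourhood_of_base_topology)
    show "B 0 \<subseteq> U"
      using V0 unit_nbhd_carrier by (auto simp: B_def zero)
    show "U \<subseteq> carrier G"
      using U topspace_eq unfolding neighbourhood_of_def by simp
  qed auto
  moreover have "?T' \<noteq> T"
  proof
    assume eq: "?T' = T"
    \<comment> \<open>Stage \<open>k\<close>, at which the identity is avoided, keeps \<open>s (Suc k)\<close> away from \<open>\<one>\<close>. If the topologies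
        agreed, some late \<open>s M\<close> would be very close to \<open>\<one>\<close>, and since \<open>s M\<close> is close to \<open>s (Suc k)\<close> this
        would put \<open>s (Suc k)\<close> into \<open>V (Suc k)\<close>. One more stage provides the room for that estimate.\<close>
    obtain k where k: "e k = \<one>" using e_surj by blast
    have "openin ?T' (V (Suc (Suc k)))"
      using V eq unit_nbhd_def by simp
    then obtain m where m: "\<forall>b\<in>B m. \<one> \<otimes> b \<in> V (Suc (Suc k))"
      using one_V base.openin_base_topology by blast
    define M where "M = max m (Suc (Suc k))"
    have "s M [^] (1::int) \<otimes> \<one> \<in> B M"
      unfolding B_def using one_V by blast
    then have "s M \<in> B M" using s by simp
    moreover have "B M \<subseteq> V (Suc (Suc k))"
    proof
      fix b assume "b \<in> B M"
      moreover have "B M \<subseteq> B m" by (rule B_mono) (simp add: M_def)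
      ultimately show "b \<in> V (Suc (Suc k))" using m Bc by fastforce
    qed
    ultimately have sM: "s M \<in> V (Suc (Suc k))" by blast
    \<comment> \<open>The Cauchy property, by downward induction from \<open>M\<close>.\<close>
    have translates: "\<exists>v \<in> V l. s M = s l \<otimes> v" if "l \<le> M" for l
      using that
    proof (induction l rule: inc_induct)
      case base
      show ?case using one_V by (rule bexI[rotated]) (simp add: s)
    next
      case (step l)
      then obtain v where v: "v \<in> V (Suc l)" "s M = s (Suc l) \<otimes> v" by blast
      have "s M = s l \<otimes> (s (Suc l) \<otimes> inv (s l)) \<otimes> v"
        using v(2) by (simp only: s_step[symmetric])
      then have "s M = s l \<otimes> (s (Suc l) \<otimes> inv (s l) \<otimes> v)"
        using s v(1) Vc by (simp add: m_assoc)
      moreover have "s (Suc l) \<otimes> inv (s l) \<otimes> v \<in> V l"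
        using small[OF v(1) one_V, of 1] s v(1) Vc by simp
      ultimately show ?case by blast
    qed
    then obtain v where v: "v \<in> V (Suc (Suc k))" "s M = s (Suc (Suc k)) \<otimes> v"
      using M_def by (metis max.cobounded2)
    let ?l = "Suc k"
    have "(s (Suc ?l) \<otimes> inv (s ?l)) [^] (- 1 :: int) \<otimes> s M \<otimes> inv v \<in> V ?l"
      using small[OF sM v(1)] .
    moreover have "(s (Suc ?l) \<otimes> inv (s ?l)) [^] (- 1 :: int) \<otimes> s M \<otimes> inv v = s ?l"
    proof -
      have vc: "v \<in> carrier G" using v(1) Vc by blast
      have "(s (Suc ?l) \<otimes> inv (s ?l)) [^] (- 1 :: int) = s ?l \<otimes> inv (s (Suc ?l))"
        using s by (simp add: int_pow_neg inv_mult m_comm)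
      also have "\<dots> \<otimes> s M \<otimes> inv v = s ?l \<otimes> (inv (s (Suc ?l)) \<otimes> s (Suc ?l)) \<otimes> (v \<otimes> inv v)"
        unfolding v(2) using s vc by (simp add: m_assoc)
      finally show ?thesis using s vc by simp
    qed
    ultimately have "s ?l \<in> V ?l" by simp
    \<comment> \<open>Stage \<open>k\<close> forbids this, since it writes \<open>e k = \<one>\<close> as \<open>s ?l [^] j \<otimes> v\<close> with \<open>j = -1\<close> and \<open>v = s ?l\<close>.\<close>
    moreover have "s ?l [^] (- 1 :: int) \<otimes> s ?l = e k"
      using s by (simp add: k int_pow_neg)
    ultimately have "int p dvd - 1" using avoid by blast
    then show False using \<open>p \<noteq> 1\<close> by simp
  qed
  ultimately show ?thesis
    using base.group_topology_base_topology by blast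
qed

end

section \<open>Locally minimal topologies on bounded countable groups\<close>

lemma discrete_group_topology:
  assumes "comm_group G"
  shows "group_topology G (discrete_topology (carrier G))"
proof -
  interpret comm_group G by fact
  show ?thesis
    unfolding group_topology_def by (auto simp: prod_topology_discrete_topology[symmetric])
qed

theorem theorem1:
  fixes G :: "('a, 'b) monoid_scheme" and n :: nat and T :: "'a topology"
  assumes "n > 0"
    and "comm_group G"
    and "countable (carrier G)"
    and "infinite (carrier G)"
    and "\<And>x. x \<in> carrier G \<Longrightarrow> x [^]\<^bsub>G\<^esub> n = \<one>\<^bsub>G\<^esub>"
  shows "locally_minimal_group_topology G T \<longleftrightarrow> T = discrete_topology (carrier G)"
proof
  assume "locally_minimal_group_topology G T"
  then obtain U where T: "group_topology G T" "Hausdorff_space T"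
    and U: "neighbourhood_of T \<one>\<^bsub>G\<^esub> U"
    and minimal: "\<And>T'. \<lbrakk>group_topology G T'; Hausdorff_space T'; weaker_topology T' T;
                          neighbourhood_of T' \<one>\<^bsub>G\<^esub> U\<rbrakk> \<Longrightarrow> T' = T"
    unfolding locally_minimal_group_topology_def by blast
  interpret Hausdorff_comm_group G T
    using assms(2) T by (simp add: Hausdorff_comm_group_def Hausdorff_comm_group_axioms_def)
  show "T = discrete_topology (carrier G)"
    using exists_weaker_topology[OF assms(3,1,5) _ U] minimal by blast
next
  assume T: "T = discrete_topology (carrier G)"
  interpret comm_group G by fact
  have "T' = T" if T': "group_topology G T'" "Hausdorff_space T'"
    and one: "neighbourhood_of T' \<one>\<^bsub>G\<^esub> {\<one>\<^bsub>G\<^esub>}" for T'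
  proof -
    interpret Hausdorff_comm_group G T'
      using assms(2) T' by (simp add: Hausdorff_comm_group_def Hausdorff_comm_group_axioms_def)
    obtain V where "openin T' V" "\<one>\<^bsub>G\<^esub> \<in> V" "V \<subseteq> {\<one>\<^bsub>G\<^esub>}"
      using one unfolding neighbourhood_of_def by blast
    moreover from this have "V = {\<one>\<^bsub>G\<^esub>}" by blast
    ultimately show ?thesis using discrete_if_open_one T by simp
  qed
  moreover have "neighbourhood_of T \<one>\<^bsub>G\<^esub> {\<one>\<^bsub>G\<^esub>}"
    unfolding neighbourhood_of_def T by (intro conjI exI[of _ "{\<one>\<^bsub>G\<^esub>}"]) simp_all
  moreover have "group_topology G T" "Hausdorff_space T"
    using discrete_group_topology[OF assms(2)] by (simp_all add: T)
  ultimately show "locally_minimal_group_topology G T"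
    unfolding locally_minimal_group_topology_def by blast
qed

end
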